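(* Let $P_0$ and $P_1$ be probability distributions on a measurable space $\mathcal{Z}$, and let $\theta_0 = \theta(P_0) \in \mathbb{R}^d$ and $\theta_1 = \theta(P_1) \in \mathbb{R}^d$ be the values of a parameter of interest at $P_0$ and $P_1$. Let $\ell : \mathbb{R}_+ \to \mathbb{R}_+$ be an arbitrary non-decreasing function, and define $\Delta = \ell\left(\tfrac12 \|\theta_0 - \theta_1\|_2\right)$. Let $\delta \in [0,\infty)$. If the estimator $\widehat{\theta} : \mathcal{Z} \to \mathbb{R}^d$ satisfies $R(\widehat{\theta}, P_0) \le \delta$, then $$R(\widehat{\theta}, P_1) \ge \left[\Delta^{1/2} - \left(\rho(P_1 \| P_0)\, \delta\right)^{1/2}\right]_+^2 .$$
   Context: $\mathbb{R}_+ = [0,\infty)$, $\|\cdot\|_2$ is the Euclidean norm, and $[x]_+ = \max\{x,0\}$. An estimator is a measurable map $\widehat\theta : \mathcal{Z} \to \mathbb{R}^d$. Its risk under a distribution $P$ with parameter $\theta(P)$ is $R(\widehat\theta, P) = \mathbb{E}_P\left[\ell(\|\widehat\theta(Z) - \theta(P)\|_2)\right]$, where $Z \sim P$ (possibly $+\infty$). The $\chi^2$-affinity is $\rho(P_1\|P_0) = D_{\chi^2}(P_1\|P_0) + 1 = \int \frac{dP_1^2}{dP_0} = \mathbb{E}_{P_0}\left[\left(\frac{dP_1}{dP_0}\right)^2\right]$, with $\rho(P_1\|P_0) = +\infty$ if $P_1$ is not absolutely continuous with respect to $P_0$; when $\rho(P_1\|P_0)=+\infty$ the right-hand side of the inequality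 is interpreted as $0$. *)

theory Defs
  imports "HOL-Probability.Probability"
begin

text \<open>The argument \<open>loss\<close>, mathematically a map \<open>[0,\<infinity>) \<rightarrow> [0,\<infinity>)\<close>, is modelled as a function on the reals that is only ever
  evaluated at non-negative arguments. The expectation is a non-negative Lebesgue integral, so the
  risk may be infinite.\<close>

definition risk ::
  "(real \<Rightarrow> real) \<Rightarrow> ('z measure \<Rightarrow> real ^ 'd) \<Rightarrow> ('z \<Rightarrow> real ^ 'd) \<Rightarrow> 'z measure \<Rightarrow> ennreal"
  where "risk loss \<theta> est P = (\<integral>\<^sup>+ z. ennreal (loss (norm (est z - \<theta> P))) \<partial>P)"

text \<open>The argument order is that of \<open>\<rho>(P\<^sub>1 \<parallel> P\<^sub>0)\<close>. In the library, both
  \<^const>\<open>absolutely_continuous\<close> and \<^const>\<open>RN_deriv\<close> take the dominating measure first.\<close>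

definition chi2_affinity :: "'z measure \<Rightarrow> 'z measure \<Rightarrow> ennreal"
  where "chi2_affinity P1 P0 =
    (if absolutely_continuous P0 P1 then \<integral>\<^sup>+ z. (RN_deriv P0 P1 z)\<^sup>2 \<partial>P0 else \<infinity>)"

end

theory Submission
  imports Defs
begin

text \<open>The triangle inequality and monotonicity make the losses \<open>A\<close>, \<open>B\<close> at \<open>\<theta> P0\<close>, \<open>\<theta> P1\<close> satisfy
  \<open>\<surd>\<Delta> \<le> \<surd>A + \<surd>B\<close> pointwise. Integrate against \<open>P1\<close>: the Cauchy-Schwarz inequality bounds the
  integral of \<open>\<surd>B\<close> by the root of the risk at \<open>P1\<close>, and, after a change of measure to \<open>P0\<close>, that of
  \<open>\<surd>A\<close> by \<open>\<surd>(\<rho> \<delta>)\<close>.\<close>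

text \<open>Monotone functions on the whole line are Borel, so monotonicity of the loss yields the
  measurability of the integrands. Precomposing with \<open>max 0\<close> extends \<open>f\<close>
  by the constant \<open>f 0\<close> to negative arguments, where nothing is known about it.\<close>

lemma mono_on_nonneg_comp_measurable:
  fixes f :: "real \<Rightarrow> real"
  assumes "mono_on {0..} f" and g: "g \<in> borel_measurable M" and "\<And>x. 0 \<le> g x"
  shows "(\<lambda>x. f (g x)) \<in> borel_measurable M"
proof -
  have "mono (\<lambda>t. f (max 0 t))"
    using assms(1) by (auto simp: mono_on_def intro!: monoI)
  then have "(\<lambda>x. f (max 0 (g x))) \<in> borel_measurable M"
    by (intro measurable_compose[OF g] borel_measurable_mono)
  with assms(3) show ?thesis by (simp add: max_def)
qed

lemma (in prob_space) nn_integral_square_le: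
  fixes f :: "'a \<Rightarrow> ennreal"
  assumes "f \<in> borel_measurable M"
  shows "(\<integral>\<^sup>+ x. f x \<partial>M)\<^sup>2 \<le> (\<integral>\<^sup>+ x. (f x)\<^sup>2 \<partial>M)"
  using Cauchy_Schwarz_nn_integral[of f M "\<lambda>_. 1"] assms by (simp add: emeasure_space_1)

lemma nn_integral_square_le_chi2_affinity:
  fixes f :: "'z \<Rightarrow> ennreal"
  assumes "prob_space P0" and "prob_space P1" and sets: "sets P1 = sets P0"
    and fin: "chi2_affinity P1 P0 \<noteq> \<infinity>" and f: "f \<in> borel_measurable P0"
  shows "(\<integral>\<^sup>+ z. f z \<partial>P1)\<^sup>2 \<le> chi2_affinity P1 P0 * (\<integral>\<^sup>+ z. (f z)\<^sup>2 \<partial>P0)"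
proof -
  interpret P0: prob_space P0 by fact
  \<comment> \<open>A finite affinity rules out the \<open>else\<close> branch of its definition, so
    \<open>P1\<close> has a density with respect to \<open>P0\<close>.\<close>
  have ac: "absolutely_continuous P0 P1"
    using fin by (auto simp: chi2_affinity_def split: if_splits)
  have "(\<integral>\<^sup>+ z. f z \<partial>P1) = (\<integral>\<^sup>+ z. RN_deriv P0 P1 z * f z \<partial>P0)"
    by (rule P0.RN_deriv_nn_integral[OF ac sets f])
  also have "\<dots>\<^sup>2 \<le> (\<integral>\<^sup>+ z. (RN_deriv P0 P1 z)\<^sup>2 \<partial>P0) * (\<integral>\<^sup>+ z. (f z)\<^sup>2 \<partial>P0)"
    using f by (intro Cauchy_Schwarz_nn_integral) simp_all
  finally show ?thesis by (simp add: chi2_affinity_def ac)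
qed

text \<open>At least one of the points \<open>a\<close>, \<open>b\<close> lies at distance at least
  \<open>1 / 2 * norm (a - b)\<close> from \<open>x\<close>. By monotonicity its summand alone
  dominates the left side; the other is nonnegative.\<close>

lemma sqrt_loss_half_norm_le:
  fixes x a b :: "'a::real_normed_vector"
  assumes nonneg: "\<And>t. 0 \<le> t \<Longrightarrow> 0 \<le> loss t" and mono: "mono_on {0..} loss"
  shows "sqrt (loss (1 / 2 * norm (a - b))) \<le> sqrt (loss (norm (x - a))) + sqrt (loss (norm (x - b)))"
proof -
  have "norm (a - b) \<le> norm (x - a) + norm (x - b)"
    using norm_triangle_ineq4[of "x - b" "x - a"] by simp
  then consider "1 / 2 * norm (a - b) \<le> norm (x - a)" | "1 / 2 * norm (a - b) \<le> norm (x - b)"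
    by linarith
  then show ?thesis
  proof cases
    case 1
    then have "sqrt (loss (1 / 2 * norm (a - b))) \<le> sqrt (loss (norm (x - a)))"
      by (intro real_sqrt_le_mono mono_onD[OF mono]) auto
    then show ?thesis using nonneg[of "norm (x - b)"] by (simp add: add_increasing2)
  next
    case 2
    then have "sqrt (loss (1 / 2 * norm (a - b))) \<le> sqrt (loss (norm (x - b)))"
      by (intro real_sqrt_le_mono mono_onD[OF mono]) auto
    then show ?thesis using nonneg[of "norm (x - a)"] by (simp add: add_increasing)
  qed
qed

text \<open>Closing arithmetic, in \<open>ennreal\<close> because \<open>v\<close> and
  \<open>r\<close> may be infinite: \<open>u\<close> is at most \<open>sqrt c\<close>, hence
  \<open>d - sqrt c\<close> is at most \<open>v\<close>.\<close>

lemma ennreal_square_max_diff_le: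
  fixes u v :: ennreal
  assumes "ennreal d \<le> u + v" and "u\<^sup>2 \<le> ennreal c" and "v\<^sup>2 \<le> r" and "0 \<le> c"
  shows "ennreal ((max (d - sqrt c) 0)\<^sup>2) \<le> r"
proof (cases "v = \<infinity>")
  case True
  with assms(3) show ?thesis by (simp add: power2_eq_square ennreal_top_mult top_unique)
next
  case False
  then obtain v' where v: "v = ennreal v'" "0 \<le> v'" by (cases v) auto
  have "u \<noteq> \<infinity>"
    using assms(2) by (auto simp: power2_eq_square ennreal_top_mult top_unique)
  then obtain u' where u: "u = ennreal u'" "0 \<le> u'" by (cases u) auto
  have "u' \<le> sqrt c"
    using assms(2,4) u by (auto simp: ennreal_power intro!: real_le_rsqrt)
  moreover have "d \<le> u' + v'"
    using assms(1) u v by (simp add: ennreal_plus[symmetric] del: ennreal_plus)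
  \<comment> \<open>Squaring preserves the order here because the positive part is nonnegative and,
    since \<open>v'\<close> is too, still at most \<open>v'\<close>.\<close>
  ultimately have "(max (d - sqrt c) 0)\<^sup>2 \<le> v'\<^sup>2"
    using v by (intro power_mono) auto
  then have "ennreal ((max (d - sqrt c) 0)\<^sup>2) \<le> v\<^sup>2"
    using v by (simp add: ennreal_power ennreal_leI)
  with assms(3) show ?thesis by (rule order_trans[rotated])
qed

theorem corollary1:
  fixes Z P0 P1 :: "'z measure"
    and \<theta> :: "'z measure \<Rightarrow> real ^ 'd"
    and \<theta>_hat :: "'z \<Rightarrow> real ^ 'd"
    and loss :: "real \<Rightarrow> real"
    and \<delta> :: real
  assumes "prob_space P0" and "sets P0 = sets Z"
    and "prob_space P1" and "sets P1 = sets Z"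
    and "\<And>t. 0 \<le> t \<Longrightarrow> 0 \<le> loss t"
    and "mono_on {0..} loss"
    and "0 \<le> \<delta>"
    and "\<theta>_hat \<in> borel_measurable Z"
    and "risk loss \<theta> \<theta>_hat P0 \<le> ennreal \<delta>"
  shows "let \<Delta> = loss (1 / 2 * norm (\<theta> P0 - \<theta> P1)); \<rho> = chi2_affinity P1 P0
    in risk loss \<theta> \<theta>_hat P1 \<ge>
         (if \<rho> = \<infinity> then 0
          else ennreal ((max (sqrt \<Delta> - sqrt (enn2real \<rho> * \<delta>)) 0)\<^sup>2))"
proof -
  interpret P1: prob_space P1 by fact
  note nonneg = assms(5) and mono = assms(6)
  define \<Delta> where "\<Delta> = loss (1 / 2 * norm (\<theta> P0 - \<theta> P1))"
  define \<rho> where "\<rho> = chi2_affinity P1 P0"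
  \<comment> \<open>Square root of the pointwise loss: the integral of
    \<open>(s P z)\<^sup>2\<close> against \<open>P\<close> is the risk at \<open>P\<close>.\<close>
  define s where "s P z = ennreal (sqrt (loss (norm (\<theta>_hat z - \<theta> P))))" for P z
  have s_sq: "(s P z)\<^sup>2 = ennreal (loss (norm (\<theta>_hat z - \<theta> P)))" for P z
    by (simp add: s_def ennreal_power nonneg)
  have "s P \<in> borel_measurable Z" for P
  proof -
    have "(\<lambda>z. loss (norm (\<theta>_hat z - \<theta> P))) \<in> borel_measurable Z"
      by (rule mono_on_nonneg_comp_measurable[OF mono]) (use assms(8) in simp_all)
    then show ?thesis
      unfolding s_def by measurable
  qed
  \<comment> \<open>Both measures are required: \<open>s P0\<close> is integrated against
    \<open>P1\<close> first and, after the change of measure, its square against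
    \<open>P0\<close>.\<close>
  then have meas: "s P \<in> borel_measurable P0" "s P \<in> borel_measurable P1" for P
    by (simp_all add: measurable_cong_sets[OF assms(2) refl] measurable_cong_sets[OF assms(4) refl])
  \<comment> \<open>The lemma is applied with \<open>u\<close>, \<open>v\<close> the integrals of
    \<open>s P0\<close>, \<open>s P1\<close> against \<open>P1\<close>, and with
    \<open>c = enn2real \<rho> * \<delta>\<close>.\<close>
  have "ennreal ((max (sqrt \<Delta> - sqrt (enn2real \<rho> * \<delta>)) 0)\<^sup>2) \<le> risk loss \<theta> \<theta>_hat P1"
    if fin: "\<rho> \<noteq> \<infinity>"
  proof (rule ennreal_square_max_diff_le)
    have "ennreal (sqrt \<Delta>) = (\<integral>\<^sup>+ z. ennreal (sqrt \<Delta>) \<partial>P1)"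
      by (simp add: P1.emeasure_space_1)
    also have "\<dots> \<le> (\<integral>\<^sup>+ z. s P0 z + s P1 z \<partial>P1)"
      unfolding s_def \<Delta>_def using sqrt_loss_half_norm_le[OF nonneg mono] nonneg
      by (intro nn_integral_mono) (simp add: ennreal_plus[symmetric] ennreal_leI del: ennreal_plus)
    also have "\<dots> = (\<integral>\<^sup>+ z. s P0 z \<partial>P1) + (\<integral>\<^sup>+ z. s P1 z \<partial>P1)"
      by (rule nn_integral_add) (fact meas)+
    finally show "ennreal (sqrt \<Delta>) \<le> \<dots>" .
    have "(\<integral>\<^sup>+ z. s P0 z \<partial>P1)\<^sup>2 \<le> \<rho> * (\<integral>\<^sup>+ z. (s P0 z)\<^sup>2 \<partial>P0)"
      unfolding \<rho>_def using assms(1-4) fin meas(1)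
      by (intro nn_integral_square_le_chi2_affinity) (simp_all add: \<rho>_def)
    \<comment> \<open>Finiteness of \<open>\<rho>\<close> makes its passage through
      \<open>enn2real\<close> lossless; the second factor is the risk at \<open>P0\<close>.\<close>
    also have "\<dots> \<le> ennreal (enn2real \<rho>) * ennreal \<delta>"
      using assms(9) fin by (intro mult_mono) (simp_all add: s_sq risk_def top.not_eq_extremum)
    finally show "(\<integral>\<^sup>+ z. s P0 z \<partial>P1)\<^sup>2 \<le> ennreal (enn2real \<rho> * \<delta>)"
      using assms(7) by (simp add: ennreal_mult)
    show "(\<integral>\<^sup>+ z. s P1 z \<partial>P1)\<^sup>2 \<le> risk loss \<theta> \<theta>_hat P1"
      using P1.nn_integral_square_le[OF meas(2)] by (simp add: s_sq risk_def)
    show "0 \<le> enn2real \<rho> * \<delta>"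
      using assms(7) by simp
  qed
  \<comment> \<open>For infinite \<open>\<rho>\<close> the claimed lower bound is 0, so only the
    finite case had content.\<close>
  then show ?thesis
    by (simp add: Let_def \<Delta>_def \<rho>_def)
qed

end
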